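(* Let $n,q,t$ be positive integers. Assume $\mathcal{A}$ is a quantum query algorithm which, given phase-oracle access to two functions $S,U:\{0,1\}^n\to\{0,1\}$ and a classical witness $w\in\{0,1\}^q$, makes at most $t$ queries to each oracle, and satisfies: if $(S,U)$ is at least $\frac{59}{100}$-spectrally Forrelated then there is $w\in\{0,1\}^q$ with $\Pr[\mathcal{A}^{(S,U)}(w)\text{ accepts}]\ge 2/3$, and if $(S,U)$ is at most $\frac{57}{100}$-spectrally Forrelated then $\Pr[\mathcal{A}^{(S,U)}(w)\text{ accepts}]\le 1/3$ for all $w\in\{0,1\}^q$. Let $(S,U)$ be at least $\frac{59}{100}$-spectrally Forrelated, and let $v\in\mathbb{N}$ be such that $(\Delta,U)$ is at most $\frac{57}{100}$-spectrally Forrelated for every subset $\Delta\subset S$ with $|\Delta|\le v$. Then there exists a query algorithm $\mathsf{CumulativeSampler}$ (depending only on $\mathcal{A}$ and $v$) that makes $0$ queries to $S$ and $vt$ queries to $U$, and outputs $v$ distinct elements of $S$ with probability at least $2^{-q}\left(\frac{1}{36t^2}\right)^v$.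
   Context: Functions $S,U:\{0,1\}^n\to\{0,1\}$ are identified with the sets $S^{-1}(1),U^{-1}(1)\subseteq\{0,1\}^n$. For sets $S,U\subseteq\{0,1\}^n$ let $\Pi_S=\sum_{x\in S}|x\rangle\langle x|$, and similarly $\Pi_U$. The pair $(S,U)$ is $\alpha$-spectrally Forrelated where $\alpha=\|\Pi_U H^{\otimes n}\Pi_S\|_{\mathrm{op}}^2$ ($H$ the Hadamard gate); "at least/at most $\alpha$-spectrally Forrelated" means this quantity is $\ge\alpha$ / $\le\alpha$. Phase-oracle access to $S$ is the unitary $|b,x\rangle|z\rangle\mapsto(-1)^{b\cdot S(x)}|b,x\rangle|z\rangle$. A query algorithm with classical witness $w$ starts in $|w\rangle|0\cdots0\rangle$, alternates arbitrary unitaries with oracle queries, and accepts by measuring its first qubit. *)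

theory Defs
  imports Complex_Main
begin

text \<open>Model of n-qubit quantum computation. Computational basis states of m qubits are
  bit strings (bool lists) of length m; the first list entry is the first qubit.
  States are amplitude functions; matrices are functions of (row, column).\<close>

type_synonym qstate = "bool list \<Rightarrow> complex"
type_synonym qmat = "bool list \<Rightarrow> bool list \<Rightarrow> complex"

definition bitstrings :: "nat \<Rightarrow> bool list set" where
  "bitstrings k = {xs. length xs = k}"

definition apply_mat :: "nat \<Rightarrow> qmat \<Rightarrow> qstate \<Rightarrow> qstate" where
  "apply_mat m M \<psi> = (\<lambda>y. \<Sum>x\<in>bitstrings m. M y x * \<psi> x)"

definition unitary_on :: "nat \<Rightarrow> qmat \<Rightarrow> bool" where
  "unitary_on m M \<longleftrightarrow> (\<forall>x\<in>bitstrings m. \<forall>y\<in>bitstrings m.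
      (\<Sum>z\<in>bitstrings m. cnj (M z x) * M z y) = (if x = y then 1 else 0))"

definition basis_state :: "bool list \<Rightarrow> qstate" where
  "basis_state x = (\<lambda>y. if y = x then 1 else 0)"

definition vnorm :: "nat \<Rightarrow> qstate \<Rightarrow> real" where
  "vnorm k \<psi> = sqrt (\<Sum>x\<in>bitstrings k. (cmod (\<psi> x))\<^sup>2)"

definition opnorm :: "nat \<Rightarrow> qmat \<Rightarrow> real" where
  "opnorm k M = Sup {vnorm k (apply_mat k M \<psi>) | \<psi>. vnorm k \<psi> = 1}"

definition had :: "nat \<Rightarrow> bool list \<Rightarrow> bool list \<Rightarrow> real" where
  "had n y x = ((-1) ^ card {i. i < n \<and> y ! i \<and> x ! i}) / sqrt (2 ^ n)"

text \<open>alpha = || Pi_U H^{\<otimes>n} Pi_S ||_op^2.\<close>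
definition spec_forr :: "nat \<Rightarrow> bool list set \<Rightarrow> bool list set \<Rightarrow> real" where
  "spec_forr n S U =
     (opnorm n (\<lambda>y x. if y \<in> U \<and> x \<in> S then complex_of_real (had n y x) else 0))\<^sup>2"

datatype orc = OrS | OrU

record qalg =
  nqubits :: nat
  first_unitary :: qmat
  steps :: "(orc \<times> qmat) list"

text \<open>Phase oracle |b,x>|z> \<mapsto> (-1)^(b*F(x)) |b,x>|z>, acting on the first n+1 qubits.\<close>
definition phase_oracle :: "nat \<Rightarrow> bool list set \<Rightarrow> qstate \<Rightarrow> qstate" where
  "phase_oracle n F \<psi> = (\<lambda>y. if y \<noteq> [] \<and> hd y \<and> take n (tl y) \<in> F then - \<psi> y else \<psi> y)"

definition oracle_of :: "nat \<Rightarrow> bool list set \<Rightarrow> bool list set \<Rightarrow> orc \<Rightarrow> qstate \<Rightarrow> qstate" where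
  "oracle_of n S U orc = (case orc of OrS \<Rightarrow> phase_oracle n S | OrU \<Rightarrow> phase_oracle n U)"

definition final_state :: "nat \<Rightarrow> qalg \<Rightarrow> bool list set \<Rightarrow> bool list set \<Rightarrow> qstate \<Rightarrow> qstate" where
  "final_state n A S U \<psi>0 =
     fold (\<lambda>(oc, V) \<psi>. apply_mat (nqubits A) V (oracle_of n S U oc \<psi>)) (steps A)
          (apply_mat (nqubits A) (first_unitary A) \<psi>0)"

definition num_queries :: "orc \<Rightarrow> qalg \<Rightarrow> nat" where
  "num_queries oc A = length (filter (\<lambda>s. fst s = oc) (steps A))"

text \<open>Well-formedness: enough qubits for the oracle registers and a q-bit witness,
  all intermediate operations unitary.\<close>
definition valid_alg :: "nat \<Rightarrow> nat \<Rightarrow> qalg \<Rightarrow> bool" where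
  "valid_alg n q A \<longleftrightarrow> nqubits A \<ge> n + 1 \<and> nqubits A \<ge> q \<and>
     unitary_on (nqubits A) (first_unitary A) \<and>
     (\<forall>s\<in>set (steps A). unitary_on (nqubits A) (snd s))"

definition acc_prob :: "nat \<Rightarrow> nat \<Rightarrow> qalg \<Rightarrow> bool list set \<Rightarrow> bool list set \<Rightarrow> bool list \<Rightarrow> real" where
  "acc_prob n q A S U w =
     (\<Sum>y\<in>{y \<in> bitstrings (nqubits A). hd y}.
        (cmod (final_state n A S U (basis_state (w @ replicate (nqubits A - q) False)) y))\<^sup>2)"

definition chunks :: "nat \<Rightarrow> nat \<Rightarrow> bool list \<Rightarrow> bool list list" where
  "chunks n v y = map (\<lambda>i. take n (drop (i * n) y)) [0..<v]"

definition sample_prob :: "nat \<Rightarrow> nat \<Rightarrow> qalg \<Rightarrow> bool list set \<Rightarrow> bool list set \<Rightarrow> real" where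
  "sample_prob n v B S U =
     (\<Sum>y\<in>{y \<in> bitstrings (nqubits B). distinct (chunks n v y) \<and> set (chunks n v y) \<subseteq> S}.
        (cmod (final_state n B S U (basis_state (replicate (nqubits B) False)) y))\<^sup>2)"

end

theory Submission
  imports Defs "HOL-Analysis.L2_Norm" "HOL-Analysis.Convex"
begin

text \<open>Guess a witness \<open>w\<close> uniformly; it is right with probability \<open>(1/2)\<^sup>q\<close>. Let \<open>\<Delta>\<close> be the set of elements of \<open>S\<close>
  found so far. Since \<open>A\<close> with witness \<open>w\<close> tells \<open>(S, U)\<close> from \<open>(\<Delta>, U)\<close>, the hybrid argument of
  Bennett, Bernstein, Brassard and Vazirani shows that the queries of \<open>A\<close> on \<open>(\<Delta>, U)\<close> put total
  weight at least \<open>1 / (36 t)\<close> on \<open>S - \<Delta>\<close>. The oracle for \<open>\<Delta>\<close> is known, so this run costs no query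
  to \<open>S\<close>, and measuring a random one of its queries yields a new element of \<open>S\<close> with probability
  at least \<open>1 / (36 t\<^sup>2)\<close>. All measurements are deferred: the found elements and \<open>w\<close> stay in a
  register that controls the later unitaries.\<close>

section \<open>Bit strings and sums over them\<close>

lemma finite_bitstrings [simp]: "finite (bitstrings k)"
  using finite_lists_length_eq[of "UNIV :: bool set" k] by (simp add: bitstrings_def)

lemma card_bitstrings: "card (bitstrings k) = 2 ^ k"
  using card_lists_length_eq[of "UNIV :: bool set" k] by (simp add: bitstrings_def)

lemma append_mem_bitstrings:
  "y \<in> bitstrings a \<Longrightarrow> z \<in> bitstrings b \<Longrightarrow> y @ z \<in> bitstrings (a + b)"
  by (simp add: bitstrings_def)

lemma bitstrings_add: "bitstrings (a + b) = (\<lambda>(y, z). y @ z) ` (bitstrings a \<times> bitstrings b)"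
proof
  show "bitstrings (a + b) \<subseteq> (\<lambda>(y, z). y @ z) ` (bitstrings a \<times> bitstrings b)"
  proof
    fix x assume "x \<in> bitstrings (a + b)"
    then have "x = (\<lambda>(y, z). y @ z) (take a x, drop a x)"
      and "(take a x, drop a x) \<in> bitstrings a \<times> bitstrings b"
      by (auto simp: bitstrings_def)
    then show "x \<in> (\<lambda>(y, z). y @ z) ` (bitstrings a \<times> bitstrings b)" by (rule image_eqI)
  qed
qed (auto simp: append_mem_bitstrings)

lemma inj_on_append_bitstrings: "inj_on (\<lambda>(y, z). y @ z) (bitstrings a \<times> B)"
  by (auto simp: inj_on_def bitstrings_def)

text \<open>The outer sum runs over the trailing bits because these will be the control register in
  a controlled unitary.\<close>

lemma sum_bitstrings_add:
  "(\<Sum>x\<in>bitstrings (a + b). f x) = (\<Sum>z\<in>bitstrings b. \<Sum>y\<in>bitstrings a. f (y @ z))"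
proof -
  have "(\<Sum>x\<in>bitstrings (a + b). f x) = (\<Sum>(y, z)\<in>bitstrings a \<times> bitstrings b. f (y @ z))"
    unfolding bitstrings_add
    by (subst sum.reindex[OF inj_on_append_bitstrings]) (simp add: case_prod_unfold)
  also have "\<dots> = (\<Sum>z\<in>bitstrings b. \<Sum>y\<in>bitstrings a. f (y @ z))"
    by (subst sum.swap) (simp add: sum.cartesian_product)
  finally show ?thesis .
qed

section \<open>Unitary matrices\<close>

definition mat_mul :: "nat \<Rightarrow> qmat \<Rightarrow> qmat \<Rightarrow> qmat" where
  "mat_mul m A B = (\<lambda>y x. \<Sum>k\<in>bitstrings m. A y k * B k x)"

lemma apply_mat_mat_mul: "apply_mat m (mat_mul m A B) \<psi> = apply_mat m A (apply_mat m B \<psi>)"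
proof
  fix y
  have "apply_mat m (mat_mul m A B) \<psi> y
      = (\<Sum>x\<in>bitstrings m. \<Sum>k\<in>bitstrings m. A y k * (B k x * \<psi> x))"
    by (simp add: apply_mat_def mat_mul_def sum_distrib_right mult.assoc)
  also have "\<dots> = (\<Sum>k\<in>bitstrings m. \<Sum>x\<in>bitstrings m. A y k * (B k x * \<psi> x))"
    by (rule sum.swap)
  finally show "apply_mat m (mat_mul m A B) \<psi> y = apply_mat m A (apply_mat m B \<psi>) y"
    by (simp add: apply_mat_def sum_distrib_left)
qed

lemma apply_mat_cong:
  "(\<And>x. x \<in> bitstrings m \<Longrightarrow> \<psi> x = \<phi> x) \<Longrightarrow> apply_mat m M \<psi> = apply_mat m M \<phi>"
  by (simp add: apply_mat_def)

lemma apply_mat_scale: "apply_mat m M (\<lambda>x. c * \<psi> x) = (\<lambda>y. c * apply_mat m M \<psi> y)"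
  by (simp add: apply_mat_def sum_distrib_left mult.left_commute)

lemma apply_mat_diff:
  "apply_mat m M (\<lambda>x. \<psi> x - \<phi> x) = (\<lambda>y. apply_mat m M \<psi> y - apply_mat m M \<phi> y)"
  by (simp add: apply_mat_def right_diff_distrib sum_subtractf)

lemma apply_mat_basis_state:
  "x \<in> bitstrings m \<Longrightarrow> apply_mat m M (basis_state x) = (\<lambda>y. M y x)"
  by (simp add: apply_mat_def basis_state_def if_distrib[of "(*) _"] cong: if_cong)

lemma unitary_inner_product:
  assumes "unitary_on m M"
  shows "(\<Sum>z\<in>bitstrings m. cnj (apply_mat m M \<psi> z) * apply_mat m M \<phi> z)
       = (\<Sum>x\<in>bitstrings m. cnj (\<psi> x) * \<phi> x)"
proof -
  let ?B = "bitstrings m"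
  have "(\<Sum>z\<in>?B. cnj (apply_mat m M \<psi> z) * apply_mat m M \<phi> z)
      = (\<Sum>z\<in>?B. \<Sum>x\<in>?B. \<Sum>y\<in>?B. cnj (\<psi> x) * \<phi> y * (cnj (M z x) * M z y))"
    unfolding apply_mat_def cnj_sum complex_cnj_mult sum_product by (simp only: mult_ac)
  also have "\<dots> = (\<Sum>x\<in>?B. \<Sum>z\<in>?B. \<Sum>y\<in>?B. cnj (\<psi> x) * \<phi> y * (cnj (M z x) * M z y))"
    by (rule sum.swap)
  also have "\<dots> = (\<Sum>x\<in>?B. \<Sum>y\<in>?B. \<Sum>z\<in>?B. cnj (\<psi> x) * \<phi> y * (cnj (M z x) * M z y))"
    by (intro sum.cong refl sum.swap)
  also have "\<dots> = (\<Sum>x\<in>?B. \<Sum>y\<in>?B. cnj (\<psi> x) * \<phi> y * (if x = y then 1 else 0))"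
    using assms by (simp add: unitary_on_def flip: sum_distrib_left)
  also have "\<dots> = (\<Sum>x\<in>?B. cnj (\<psi> x) * \<phi> x)"
    by (simp add: if_distrib[of "(*) _"] cong: if_cong)
  finally show ?thesis .
qed

text \<open>The columns of the product are the images under \<open>A\<close> of the columns of
  \<open>B\<close>, and \<open>A\<close> preserves their inner products.\<close>

lemma unitary_on_mat_mul:
  assumes "unitary_on m A" "unitary_on m B"
  shows "unitary_on m (mat_mul m A B)"
  using assms(2) unitary_inner_product[OF assms(1), of "\<lambda>k. B k _" "\<lambda>k. B k _"]
  by (simp add: unitary_on_def mat_mul_def apply_mat_def)

definition perm_mat :: "(bool list \<Rightarrow> bool list) \<Rightarrow> qmat" where
  "perm_mat f = (\<lambda>y x. if y = f x then 1 else 0)"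

lemma unitary_on_perm_mat:
  assumes "inj_on f (bitstrings m)" "f ` bitstrings m \<subseteq> bitstrings m"
  shows "unitary_on m (perm_mat f)"
  using assms by (auto simp: unitary_on_def perm_mat_def inj_on_eq_iff image_subset_iff
      if_distrib[of cnj] if_distrib[of "\<lambda>a. a * _"] cong: if_cong)

lemma apply_perm_mat:
  assumes "inj_on f (bitstrings m)" "x \<in> bitstrings m"
  shows "apply_mat m (perm_mat f) \<psi> (f x) = \<psi> x"
proof -
  have "apply_mat m (perm_mat f) \<psi> (f x) = (\<Sum>x'\<in>bitstrings m. if x = x' then \<psi> x' else 0)"
    unfolding apply_mat_def perm_mat_def using assms
    by (intro sum.cong) (auto simp: inj_on_eq_iff)
  then show ?thesis using assms by simp
qed

text \<open>As a diagonal matrix, the oracle of a known set can enter a circuit as a free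
  unitary.\<close>

definition phase_mat :: "nat \<Rightarrow> bool list set \<Rightarrow> qmat" where
  "phase_mat n F = (\<lambda>y x. if y = x then phase_oracle n F (\<lambda>_. 1) x else 0)"

lemma phase_oracle_eq: "phase_oracle n F \<psi> y = phase_oracle n F (\<lambda>_. 1) y * \<psi> y"
  by (simp add: phase_oracle_def)

lemma cmod_phase_oracle [simp]: "cmod (phase_oracle n F \<psi> y) = cmod (\<psi> y)"
  by (simp add: phase_oracle_def)

lemma apply_phase_mat: "y \<in> bitstrings m \<Longrightarrow> apply_mat m (phase_mat n F) \<psi> y = phase_oracle n F \<psi> y"
  by (subst phase_oracle_eq) (simp add: apply_mat_def phase_mat_def if_distrib[of "\<lambda>a. a * _"] cong: if_cong)

lemma unitary_on_phase_mat: "unitary_on m (phase_mat n F)"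
  by (auto simp: unitary_on_def phase_mat_def phase_oracle_def if_distrib[of cnj] if_distrib[of "\<lambda>a. a * _"] cong: if_cong)

text \<open>The control register stands behind the target because \<open>phase_oracle\<close> acts
  on the leading qubits: a controlled circuit can then query the oracle on its own register.\<close>

definition controlled_mat :: "nat \<Rightarrow> (bool list \<Rightarrow> qmat) \<Rightarrow> qmat" where
  "controlled_mat m V = (\<lambda>y x. if drop m y = drop m x
     then V (drop m x) (take m y) (take m x) else 0)"

lemma controlled_mat_append:
  "z \<in> bitstrings m \<Longrightarrow> x \<in> bitstrings m \<Longrightarrow>
   controlled_mat m V (z @ d) (x @ c) = (if d = c then V c z x else 0)"
  by (simp add: controlled_mat_def bitstrings_def)

lemma apply_controlled_mat:
  assumes "z \<in> bitstrings m" "c \<in> bitstrings k"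
  shows "apply_mat (m + k) (controlled_mat m V) \<psi> (z @ c)
       = apply_mat m (V c) (\<lambda>x. \<psi> (x @ c)) z"
proof -
  have "apply_mat (m + k) (controlled_mat m V) \<psi> (z @ c)
      = (\<Sum>d\<in>bitstrings k. \<Sum>x\<in>bitstrings m. controlled_mat m V (z @ c) (x @ d) * \<psi> (x @ d))"
    by (simp add: apply_mat_def sum_bitstrings_add)
  also have "\<dots> = (\<Sum>d\<in>bitstrings k. if c = d then \<Sum>x\<in>bitstrings m. V d z x * \<psi> (x @ d) else 0)"
    using assms by (intro sum.cong) (auto simp: controlled_mat_append)
  finally show ?thesis using assms by (simp add: apply_mat_def)
qed

text \<open>The matrix is block diagonal with one unitary block for each control string, and columns
  from different blocks have disjoint supports.\<close>

lemma unitary_on_controlled_mat: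
  assumes "\<And>c. c \<in> bitstrings k \<Longrightarrow> unitary_on m (V c)"
  shows "unitary_on (m + k) (controlled_mat m V)"
  unfolding unitary_on_def
proof (intro ballI)
  fix x y assume "x \<in> bitstrings (m + k)" "y \<in> bitstrings (m + k)"
  then obtain a c b d where x: "x = a @ c" "a \<in> bitstrings m" "c \<in> bitstrings k"
    and y: "y = b @ d" "b \<in> bitstrings m" "d \<in> bitstrings k"
    unfolding bitstrings_add by auto
  have "(\<Sum>z\<in>bitstrings (m + k). cnj (controlled_mat m V z x) * controlled_mat m V z y)
      = (\<Sum>e\<in>bitstrings k. \<Sum>z\<in>bitstrings m.
           cnj (controlled_mat m V (z @ e) x) * controlled_mat m V (z @ e) y)"
    by (rule sum_bitstrings_add)
  also have "\<dots> = (\<Sum>e\<in>bitstrings k. if e = c then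
        if c = d then \<Sum>z\<in>bitstrings m. cnj (V c z a) * V c z b else 0 else 0)"
    using x y by (intro sum.cong) (auto simp: controlled_mat_append)
  also have "\<dots> = (if x = y then 1 else 0)"
  proof -
    have "(\<Sum>z\<in>bitstrings m. cnj (V c z a) * V c z b) = (if a = b then 1 else 0)"
      using assms[OF x(3)] x(2) y(2) unfolding unitary_on_def by blast
    moreover have "x = y \<longleftrightarrow> a = b \<and> c = d"
      using x y by (auto simp: bitstrings_def)
    ultimately show ?thesis using x(3) by (cases "c = d") auto
  qed
  finally show "(\<Sum>z\<in>bitstrings (m + k). cnj (controlled_mat m V z x) * controlled_mat m V z y)
      = (if x = y then 1 else 0)" .
qed

text \<open>A Householder reflection; if \<open>a\<close> is already the basis vector \<open>e\<close>, division by
  zero turns it into the identity.\<close>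

lemma unitary_with_real_column:
  fixes a :: "bool list \<Rightarrow> real"
  assumes a: "(\<Sum>x\<in>bitstrings m. (a x)\<^sup>2) = 1" and e: "e \<in> bitstrings m"
  shows "\<exists>M. unitary_on m M \<and> (\<forall>y\<in>bitstrings m. M y e = complex_of_real (a y))"
proof -
  let ?B = "bitstrings m"
  define u where "u y = a y - (if y = e then 1 else 0)" for y
  define s where "s = (\<Sum>y\<in>?B. (u y)\<^sup>2)"
  define M :: "bool list \<Rightarrow> bool list \<Rightarrow> real"
    where "M y x = (if y = x then 1 else 0) - 2 / s * u y * u x" for y x
  have "(u y)\<^sup>2 = (a y)\<^sup>2 + (if y = e then 1 - 2 * a e else 0)" for y
    by (simp add: u_def power2_diff)
  then have s: "s = 2 - 2 * a e"
    using a e by (simp add: s_def sum.distrib)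
  have orth: "(\<Sum>z\<in>?B. M z x * M z y) = (if x = y then 1 else 0)" if "x \<in> ?B" "y \<in> ?B" for x y
  proof -
    have "M z x * M z y = (if z = x then (if x = y then 1 else 0) else 0)
       - (if z = x then 2 / s * u x * u y else 0) - (if z = y then 2 / s * u x * u y else 0)
       + (2 / s)\<^sup>2 * u x * u y * (u z)\<^sup>2" for z
      by (auto simp: M_def algebra_simps power2_eq_square)
    then have "(\<Sum>z\<in>?B. M z x * M z y) = (if x = y then 1 else 0) - 2 * (2 / s * u x * u y)
        + (2 / s)\<^sup>2 * u x * u y * s"
      using that by (simp add: sum.distrib sum_subtractf s_def flip: sum_distrib_left)
    \<comment> \<open>For nonzero \<open>s\<close> the last term equals
      \<open>4 / s * u x * u y\<close> and cancels the middle one.\<close>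
    then show ?thesis by (cases "s = 0") (auto simp: power2_eq_square)
  qed
  have col: "M y e = a y" if "y \<in> ?B" for y
  proof (cases "s = 0")
    case True
    then have "(u y)\<^sup>2 = 0"
      using that by (simp add: s_def sum_nonneg_eq_0_iff)
    then show ?thesis using True by (simp add: M_def u_def)
  next
    case False
    \<comment> \<open>Here \<open>u e = a e - 1 = - s / 2\<close>, which is where the norm of
      \<open>a\<close> being 1 enters.\<close>
    have "2 / s * u e = -1"
      using False s by (simp add: u_def field_simps)
    moreover have "M y e = (if y = e then 1 else 0) - (2 / s * u e) * u y"
      by (simp add: M_def)
    ultimately have "M y e = (if y = e then 1 else 0) - (- 1) * u y" by (simp only:)
    then show ?thesis by (simp add: u_def)
  qed
  have "unitary_on m (\<lambda>y x. complex_of_real (M y x))"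
    unfolding unitary_on_def
  proof (intro ballI)
    fix x y assume "x \<in> ?B" "y \<in> ?B"
    have "(\<Sum>z\<in>?B. cnj (complex_of_real (M z x)) * complex_of_real (M z y))
        = complex_of_real (\<Sum>z\<in>?B. M z x * M z y)" by simp
    then show "(\<Sum>z\<in>?B. cnj (complex_of_real (M z x)) * complex_of_real (M z y))
        = (if x = y then 1 else 0)"
      using orth \<open>x \<in> ?B\<close> \<open>y \<in> ?B\<close> by simp
  qed
  then show ?thesis
    by (rule exI[of _ "\<lambda>y x. complex_of_real (M y x)", OF conjI]) (simp add: col)
qed

section \<open>Norms\<close>

lemma vnorm_eq_L2_set: "vnorm m \<psi> = L2_set (\<lambda>x. cmod (\<psi> x)) (bitstrings m)"
  by (simp add: vnorm_def L2_set_def)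

lemma vnorm_nonneg: "0 \<le> vnorm m \<psi>"
  by (simp add: vnorm_def sum_nonneg)

lemma vnorm_power2: "(vnorm m \<psi>)\<^sup>2 = (\<Sum>x\<in>bitstrings m. (cmod (\<psi> x))\<^sup>2)"
  by (simp add: vnorm_def sum_nonneg)

text \<open>The pointwise bound on moduli lets the summands carry arbitrary signs, as they do in the
  hybrid argument.\<close>

lemma vnorm_triangle:
  assumes "\<And>x. x \<in> bitstrings m \<Longrightarrow> cmod (\<psi> x) \<le> cmod (\<phi> x) + cmod (\<chi> x)"
  shows "vnorm m \<psi> \<le> vnorm m \<phi> + vnorm m \<chi>"
proof -
  have "vnorm m \<psi> \<le> L2_set (\<lambda>x. cmod (\<phi> x) + cmod (\<chi> x)) (bitstrings m)"
    unfolding vnorm_eq_L2_set using assms by (intro L2_set_mono) auto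
  also have "\<dots> \<le> vnorm m \<phi> + vnorm m \<chi>"
    unfolding vnorm_eq_L2_set by (rule L2_set_triangle_ineq)
  finally show ?thesis .
qed

lemma vnorm_unitary:
  assumes "unitary_on m M"
  shows "vnorm m (apply_mat m M \<psi>) = vnorm m \<psi>"
proof -
  have "complex_of_real ((vnorm m \<phi>)\<^sup>2) = (\<Sum>x\<in>bitstrings m. cnj (\<phi> x) * \<phi> x)" for \<phi>
    unfolding vnorm_power2 of_real_sum
    by (intro sum.cong refl) (simp only: complex_norm_square mult.commute)
  then have "complex_of_real ((vnorm m (apply_mat m M \<psi>))\<^sup>2) = complex_of_real ((vnorm m \<psi>)\<^sup>2)"
    using unitary_inner_product[OF assms, of \<psi> \<psi>] by simp
  then have "(vnorm m (apply_mat m M \<psi>))\<^sup>2 = (vnorm m \<psi>)\<^sup>2" by (simp only: of_real_eq_iff)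
  then show ?thesis by (simp add: vnorm_nonneg power2_eq_iff_nonneg)
qed

lemma vnorm_phase_oracle: "vnorm m (phase_oracle n F \<psi>) = vnorm m \<psi>"
  by (simp add: vnorm_def)

lemma vnorm_basis_state: "x \<in> bitstrings m \<Longrightarrow> vnorm m (basis_state x) = 1"
  by (simp add: vnorm_def basis_state_def if_distrib[of cmod] if_distrib[of "\<lambda>a. a ^ _"] cong: if_cong)

text \<open>The difference of acceptance probabilities is half of
  \<open>Re \<langle>\<psi> - \<phi>| 2 \<Pi> - 1 |\<psi> + \<phi>\<rangle>\<close>, because \<open>Re \<langle>\<psi> - \<phi>|\<psi> + \<phi>\<rangle> = 0\<close> for unit vectors.
  This gives the constant 1 where bounding with \<open>\<Pi>\<close> directly would only give 2.\<close>

lemma prob_diff_le_vnorm_diff: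
  assumes "vnorm m \<psi> = 1" "vnorm m \<phi> = 1" and "E \<subseteq> bitstrings m"
  shows "(\<Sum>y\<in>E. (cmod (\<psi> y))\<^sup>2) - (\<Sum>y\<in>E. (cmod (\<phi> y))\<^sup>2) \<le> vnorm m (\<lambda>y. \<psi> y - \<phi> y)"
proof -
  let ?B = "bitstrings m"
  define d where "d y = (cmod (\<psi> y))\<^sup>2 - (cmod (\<phi> y))\<^sup>2" for y
  have d: "\<bar>d y\<bar> \<le> cmod (\<psi> y - \<phi> y) * cmod (\<psi> y + \<phi> y)" for y
  proof -
    have "d y = Re ((\<psi> y - \<phi> y) * cnj (\<psi> y + \<phi> y))"
      by (simp add: d_def cmod_power2) algebra
    then show ?thesis
      using abs_Re_le_cmod[of "(\<psi> y - \<phi> y) * cnj (\<psi> y + \<phi> y)"]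
      by (simp add: norm_mult flip: complex_cnj_add)
  qed
  have "sum d ?B = 0"
    using vnorm_power2[of m \<psi>] vnorm_power2[of m \<phi>] assms by (simp add: d_def sum_subtractf)
  then have "2 * sum d E = sum d E - sum d (?B - E)"
    using sum.subset_diff[of E ?B d] assms by simp
  also have "\<dots> \<le> (\<Sum>y\<in>E. \<bar>d y\<bar>) + (\<Sum>y\<in>?B - E. \<bar>d y\<bar>)"
    using sum_abs[of d E] sum_abs[of d "?B - E"] by linarith
  also have "\<dots> = (\<Sum>y\<in>?B. \<bar>d y\<bar>)"
    using sum.subset_diff[of E ?B "\<lambda>y. \<bar>d y\<bar>"] assms by simp
  also have "\<dots> \<le> (\<Sum>y\<in>?B. \<bar>cmod (\<psi> y - \<phi> y)\<bar> * \<bar>cmod (\<psi> y + \<phi> y)\<bar>)"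
    by (intro sum_mono) (simp add: d)
  also have "\<dots> \<le> vnorm m (\<lambda>y. \<psi> y - \<phi> y) * vnorm m (\<lambda>y. \<psi> y + \<phi> y)"
    unfolding vnorm_eq_L2_set by (rule L2_set_mult_ineq)
  also have "\<dots> \<le> vnorm m (\<lambda>y. \<psi> y - \<phi> y) * 2"
    using vnorm_triangle[of m "\<lambda>y. \<psi> y + \<phi> y" \<psi> \<phi>] assms
    by (intro mult_left_mono vnorm_nonneg) (auto simp: norm_triangle_ineq)
  finally show ?thesis by (simp add: d_def sum_subtractf)
qed

section \<open>Circuits that query one oracle\<close>

text \<open>A circuit is kept as the operator that it computes for each \<open>U\<close>, together
  with its exact number of queries. Composition and control can then be treated on operators,
  without any syntax of algorithms.\<close>

inductive circ :: "nat \<Rightarrow> nat \<Rightarrow> nat \<Rightarrow> (bool list set \<Rightarrow> qstate \<Rightarrow> qstate) \<Rightarrow> bool" for n m where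
  circ_unitary: "unitary_on m M \<Longrightarrow> circ n m 0 (\<lambda>U. apply_mat m M)"
| circ_query: "circ n m u F \<Longrightarrow> unitary_on m M \<Longrightarrow>
    circ n m (Suc u) (\<lambda>U \<psi>. apply_mat m M (phase_oracle n U (F U \<psi>)))"

inductive_cases circ_0E: "circ n m 0 F"
inductive_cases circ_SucE: "circ n m (Suc u) F"

text \<open>The new unitary merges with the last one of the circuit, so the query count stays the
  same.\<close>

lemma circ_apply_mat:
  assumes "circ n m u F" "unitary_on m M"
  shows "circ n m u (\<lambda>U \<psi>. apply_mat m M (F U \<psi>))"
  using assms(1)
proof cases
  case (circ_unitary M')
  moreover have "apply_mat m (mat_mul m M M') = (\<lambda>\<psi>. apply_mat m M (apply_mat m M' \<psi>))"
    by (intro ext) (simp only: apply_mat_mat_mul)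
  ultimately show ?thesis
    using circ.circ_unitary[OF unitary_on_mat_mul[OF assms(2)], of M' n] by simp
next
  case (circ_query u' F' M')
  then show ?thesis
    using circ.circ_query[OF _ unitary_on_mat_mul[OF assms(2)], of n u' F' M']
    by (simp add: apply_mat_mat_mul)
qed

lemma circ_comp:
  assumes "circ n m u F"
  shows "circ n m v G \<Longrightarrow> circ n m (u + v) (\<lambda>U \<psi>. G U (F U \<psi>))"
proof (induction rule: circ.induct)
  case (circ_unitary M)
  then show ?case using circ_apply_mat[OF assms] by simp
next
  case (circ_query v G M)
  then show ?case using circ.circ_query[of n m "u + v" "\<lambda>U \<psi>. G U (F U \<psi>)" M] by simp
qed

text \<open>A state is a function on all bit strings, but the first unitary of a circuit reads only
  its values at strings of length \<open>m\<close>.\<close>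

lemma circ_cong:
  assumes "circ n m u F" "\<And>x. x \<in> bitstrings m \<Longrightarrow> \<psi> x = \<phi> x"
  shows "F U \<psi> = F U \<phi>"
  using assms(1)
proof induction
  case (circ_unitary M)
  then show ?case using assms(2) by (intro apply_mat_cong)
qed simp

lemma circ_scale:
  assumes "circ n m u F"
  shows "F U (\<lambda>x. c * \<psi> x) = (\<lambda>y. c * F U \<psi> y)"
  using assms
proof induction
  case (circ_query u F M)
  have "phase_oracle n U (\<lambda>y. c * F U \<psi> y) = (\<lambda>y. c * phase_oracle n U (F U \<psi>) y)"
    by (auto simp: phase_oracle_def)
  then show ?case using circ_query by (simp add: apply_mat_scale)
qed (simp add: apply_mat_scale)

text \<open>Trailing queries followed by the identity only change phases, so they serve to
  make query counts equal.\<close>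

lemma circ_pad:
  assumes "circ n m u F" "u \<le> v"
  shows "\<exists>G. circ n m v G \<and> (\<forall>U \<psi>. \<forall>y\<in>bitstrings m. cmod (G U \<psi> y) = cmod (F U \<psi> y))"
  using assms(2)
proof (induction v rule: dec_induct)
  case base
  then show ?case using assms(1) by blast
next
  case (step v)
  then obtain G where G: "circ n m v G"
    "\<And>U \<psi> y. y \<in> bitstrings m \<Longrightarrow> cmod (G U \<psi> y) = cmod (F U \<psi> y)" by blast
  let ?I = "perm_mat (\<lambda>x. x)"
  let ?G = "\<lambda>U \<psi>. apply_mat m ?I (phase_oracle n U (G U \<psi>))"
  have "circ n m (Suc v) ?G"
    by (intro circ_query G unitary_on_perm_mat) auto
  moreover have "cmod (?G U \<psi> y) = cmod (F U \<psi> y)" if "y \<in> bitstrings m" for U \<psi> y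
    using apply_perm_mat[of "\<lambda>x. x" m y] that G by simp
  ultimately show ?case by blast
qed

text \<open>All circuits of the family have the same number of queries, so their queries line up:
  one query on the joint register serves every control string, and only the unitaries in between are
  controlled.\<close>

lemma circ_controlled:
  assumes "n < m" and "\<And>c. c \<in> bitstrings k \<Longrightarrow> circ n m u (F c)"
  shows "\<exists>G. circ n (m + k) u G \<and> (\<forall>U \<psi>. \<forall>c\<in>bitstrings k. \<forall>z\<in>bitstrings m.
    G U \<psi> (z @ c) = F c U (\<lambda>x. \<psi> (x @ c)) z)"
  using assms(2)
proof (induction u arbitrary: F)
  case 0
  then have "\<forall>c\<in>bitstrings k. \<exists>V. unitary_on m V \<and> F c = (\<lambda>U. apply_mat m V)"
    by (auto elim: circ_0E)
  then obtain V where V: "\<And>c. c \<in> bitstrings k \<Longrightarrow> unitary_on m (V c)"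
    "\<And>c. c \<in> bitstrings k \<Longrightarrow> F c = (\<lambda>U. apply_mat m (V c))" by metis
  then have "circ n (m + k) 0 (\<lambda>U. apply_mat (m + k) (controlled_mat m V))"
    by (intro circ_unitary unitary_on_controlled_mat)
  with V show ?case
    by (intro exI[of _ "\<lambda>U. apply_mat (m + k) (controlled_mat m V)"]) (auto simp: apply_controlled_mat)
next
  case (Suc u)
  have "\<forall>c\<in>bitstrings k. \<exists>F' V. circ n m u F' \<and> unitary_on m V \<and>
      F c = (\<lambda>U \<psi>. apply_mat m V (phase_oracle n U (F' U \<psi>)))"
  proof
    fix c assume "c \<in> bitstrings k"
    from Suc.prems[OF this] show "\<exists>F' V. circ n m u F' \<and> unitary_on m V \<and>
        F c = (\<lambda>U \<psi>. apply_mat m V (phase_oracle n U (F' U \<psi>)))"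
      by (rule circ_SucE) (intro exI conjI)
  qed
  from bchoice[OF this] obtain F' where "\<forall>c\<in>bitstrings k. \<exists>V. circ n m u (F' c) \<and>
      unitary_on m V \<and> F c = (\<lambda>U \<psi>. apply_mat m V (phase_oracle n U (F' c U \<psi>)))"
    by (rule exE)
  from bchoice[OF this] obtain V where FV: "\<forall>c\<in>bitstrings k. circ n m u (F' c) \<and>
      unitary_on m (V c) \<and> F c = (\<lambda>U \<psi>. apply_mat m (V c) (phase_oracle n U (F' c U \<psi>)))"
    by (rule exE)
  then have F': "circ n m u (F' c)" and V: "unitary_on m (V c)"
    and F: "F c = (\<lambda>U \<psi>. apply_mat m (V c) (phase_oracle n U (F' c U \<psi>)))"
    if "c \<in> bitstrings k" for c
    using that by simp_all
  from Suc.IH[of F', OF F'] obtain G where G: "circ n (m + k) u G"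
    "\<And>U \<psi> c z. c \<in> bitstrings k \<Longrightarrow> z \<in> bitstrings m \<Longrightarrow>
       G U \<psi> (z @ c) = F' c U (\<lambda>x. \<psi> (x @ c)) z" by blast
  let ?G = "\<lambda>U \<psi>. apply_mat (m + k) (controlled_mat m V) (phase_oracle n U (G U \<psi>))"
  have "circ n (m + k) (Suc u) ?G"
    by (intro circ_query G unitary_on_controlled_mat V)
  moreover have "?G U \<psi> (z @ c) = F c U (\<lambda>x. \<psi> (x @ c)) z"
    if c: "c \<in> bitstrings k" and z: "z \<in> bitstrings m" for U \<psi> c z
  proof -
    \<comment> \<open>Since \<open>n < m\<close>, the control bit and the queried string both lie
      within \<open>x\<close>.\<close>
    have "phase_oracle n U (G U \<psi>) (x @ c) = phase_oracle n U (F' c U (\<lambda>x. \<psi> (x @ c))) x"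
      if "x \<in> bitstrings m" for x
    proof (cases x)
      case Nil
      then show ?thesis using that assms(1) by (simp add: bitstrings_def)
    next
      case (Cons b x')
      then show ?thesis
        using that assms(1) G(2)[OF c that, of U \<psi>] by (auto simp: phase_oracle_def bitstrings_def)
    qed
    then have "apply_mat m (V c) (\<lambda>x. phase_oracle n U (G U \<psi>) (x @ c))
        = apply_mat m (V c) (phase_oracle n U (F' c U (\<lambda>x. \<psi> (x @ c))))"
      by (rule apply_mat_cong)
    then show ?thesis
      using c z by (simp add: apply_controlled_mat F)
  qed
  ultimately show ?case by (intro exI[of _ ?G] conjI allI ballI)
qed

text \<open>This leads back from operators to algorithms. No step queries the first oracle, hence
  one algorithm serves all \<open>S\<close>.\<close>

lemma circ_imp_qalg:
  assumes "circ n m u F" "n < m"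
  shows "\<exists>B. valid_alg n 0 B \<and> nqubits B = m \<and> num_queries OrS B = 0 \<and> num_queries OrU B = u \<and>
    (\<forall>S U \<psi>. final_state n B S U \<psi> = F U \<psi>)"
  using assms(1)
proof induction
  case (circ_unitary M)
  then show ?case using assms(2)
    by (intro exI[of _ "\<lparr>nqubits = m, first_unitary = M, steps = []\<rparr>"])
      (auto simp: valid_alg_def num_queries_def final_state_def)
next
  case (circ_query u F M)
  then obtain B where "valid_alg n 0 B" "nqubits B = m" "num_queries OrS B = 0"
    "num_queries OrU B = u" "\<And>S U \<psi>. final_state n B S U \<psi> = F U \<psi>" by blast
  with circ_query(2) show ?case
    by (intro exI[of _ "B\<lparr>steps := steps B @ [(OrU, M)]\<rparr>"])
      (auto simp: valid_alg_def num_queries_def final_state_def oracle_of_def)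
qed

text \<open>For a fixed \<open>S\<close> every query to it is the unitary
  \<open>phase_mat n S\<close> and is absorbed, so that only queries to \<open>U\<close> are
  counted. The sampler uses this with the known set \<Delta> in place of \<open>S\<close>.\<close>

lemma circ_final_state:
  assumes "unitary_on m (first_unitary A)" "\<forall>s\<in>set (steps A). unitary_on m (snd s)"
    "nqubits A = m"
  shows "circ n m (num_queries OrU A) (\<lambda>U. final_state n A S U)"
proof -
  define X where "X = first_unitary A"
  define G where "G xs U \<psi> = fold (\<lambda>(oc, V) \<psi>. apply_mat m V (oracle_of n S U oc \<psi>)) xs (apply_mat m X \<psi>)"
    for xs U \<psi>
  have "circ n m (length (filter (\<lambda>s. fst s = OrU) xs)) (G xs)"
    if "\<forall>s\<in>set xs. unitary_on m (snd s)" for xs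
    using that
  proof (induction xs rule: rev_induct)
    case Nil
    show ?case using circ_unitary[of m X] assms(1) by (simp add: G_def[abs_def] X_def)
  next
    case (snoc s xs)
    obtain oc V where s: "s = (oc, V)" by force
    have IH: "circ n m (length (filter (\<lambda>s. fst s = OrU) xs)) (G xs)" and V: "unitary_on m V"
      using snoc s by auto
    show ?case
    proof (cases oc)
      case OrS
      \<comment> \<open>The matrix and the oracle need agree only on strings of length
        \<open>m\<close>, which are all that \<open>V\<close> reads.\<close>
      have "apply_mat m V (phase_oracle n S \<psi>) = apply_mat m V (apply_mat m (phase_mat n S) \<psi>)" for \<psi>
        by (rule apply_mat_cong) (simp add: apply_phase_mat)
      then have "G (xs @ [s]) = (\<lambda>U \<psi>. apply_mat m V (apply_mat m (phase_mat n S) (G xs U \<psi>)))"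
        by (simp add: G_def[abs_def] s OrS oracle_of_def)
      then show ?thesis
        using circ_apply_mat[OF circ_apply_mat[OF IH unitary_on_phase_mat] V] s OrS by simp
    next
      case OrU
      then have "G (xs @ [s]) = (\<lambda>U \<psi>. apply_mat m V (phase_oracle n U (G xs U \<psi>)))"
        by (simp add: G_def[abs_def] s oracle_of_def)
      then show ?thesis using circ_query[OF IH V] s OrU by simp
    qed
  qed
  from this[of "steps A"] show ?thesis
    using assms by (simp add: G_def[abs_def] num_queries_def final_state_def[abs_def] X_def)
qed

section \<open>Output distributions\<close>

text \<open>All qubits are measured once, at the end, after a start in the all-zero state. Only the
  values of \<open>P U\<close> at strings of length \<open>m\<close> are constrained.\<close>

definition samplable :: "nat \<Rightarrow> nat \<Rightarrow> nat \<Rightarrow> (bool list set \<Rightarrow> bool list \<Rightarrow> real) \<Rightarrow> bool" where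
  "samplable n m u P \<longleftrightarrow> (\<exists>F. circ n m u F \<and> (\<forall>U. \<forall>y\<in>bitstrings m.
     P U y = (cmod (F U (basis_state (replicate m False)) y))\<^sup>2))"

lemma samplable_nonneg: "samplable n m u P \<Longrightarrow> y \<in> bitstrings m \<Longrightarrow> 0 \<le> P U y"
  by (auto simp: samplable_def)

lemma replicate_mem_bitstrings [simp]: "replicate m b \<in> bitstrings m"
  by (simp add: bitstrings_def)

text \<open>The amplitudes \<open>sqrt (p y)\<close> form a unit vector, and some unitary has this
  vector as its column at the all-zero string.\<close>

lemma samplable_const:
  assumes "\<And>y. y \<in> bitstrings m \<Longrightarrow> 0 \<le> p y" "(\<Sum>y\<in>bitstrings m. p y) = 1"
  shows "samplable n m 0 (\<lambda>U. p)"
proof -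
  have "(\<Sum>y\<in>bitstrings m. (sqrt (p y))\<^sup>2) = 1" using assms by simp
  then obtain M where M: "unitary_on m M"
    "\<forall>y\<in>bitstrings m. M y (replicate m False) = complex_of_real (sqrt (p y))"
    using unitary_with_real_column[of "\<lambda>y. sqrt (p y)" m "replicate m False"] by auto
  then show ?thesis
    unfolding samplable_def
    by (intro exI[of _ "\<lambda>U. apply_mat m M"]) (auto simp: assms circ_unitary apply_mat_basis_state)
qed

lemma samplable_perm:
  assumes "samplable n m u P" "inj_on f (bitstrings m)" "f ` bitstrings m \<subseteq> bitstrings m"
  shows "\<exists>P'. samplable n m u P' \<and> (\<forall>U. \<forall>y\<in>bitstrings m. P' U (f y) = P U y)"
proof -
  obtain F where F: "circ n m u F"
    "\<And>U y. y \<in> bitstrings m \<Longrightarrow> P U y = (cmod (F U (basis_state (replicate m False)) y))\<^sup>2"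
    using assms(1) unfolding samplable_def by blast
  let ?F = "\<lambda>U \<psi>. apply_mat m (perm_mat f) (F U \<psi>)"
  have "samplable n m u (\<lambda>U y. (cmod (?F U (basis_state (replicate m False)) y))\<^sup>2)"
    unfolding samplable_def using circ_apply_mat[OF F(1) unitary_on_perm_mat[OF assms(2,3)]] by blast
  moreover have "\<forall>U. \<forall>y\<in>bitstrings m.
      (cmod (?F U (basis_state (replicate m False)) (f y)))\<^sup>2 = P U y"
    by (simp add: apply_perm_mat[OF assms(2)] F)
  ultimately show ?thesis by (intro exI conjI)
qed

text \<open>Run the first sampler on its own register, move its register behind a fresh one, and run
  on the fresh register the second sampler, controlled by the first outcome.\<close>

lemma samplable_bind:
  assumes P: "samplable n m u P" and Q: "\<And>y. y \<in> bitstrings m \<Longrightarrow> samplable n k v (Q y)"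
    and "n < m" "n < k"
  shows "\<exists>R. samplable n (k + m) (u + v) R \<and>
    (\<forall>U. \<forall>y\<in>bitstrings m. \<forall>z\<in>bitstrings k. R U (z @ y) = P U y * Q y U z)"
proof -
  let ?e = "\<lambda>m. basis_state (replicate m False)"
  obtain F where F: "circ n m u F"
    "\<And>U y. y \<in> bitstrings m \<Longrightarrow> P U y = (cmod (F U (?e m) y))\<^sup>2"
    using P unfolding samplable_def by blast
  have "\<forall>y\<in>bitstrings m. \<exists>G. circ n k v G \<and> (\<forall>U. \<forall>z\<in>bitstrings k. Q y U z = (cmod (G U (?e k) z))\<^sup>2)"
    using Q unfolding samplable_def by blast
  from bchoice[OF this] obtain G where "\<forall>y\<in>bitstrings m. circ n k v (G y) \<and>
      (\<forall>U. \<forall>z\<in>bitstrings k. Q y U z = (cmod (G y U (?e k) z))\<^sup>2)" by (rule exE)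
  then have G: "\<And>y. y \<in> bitstrings m \<Longrightarrow> circ n k v (G y)"
    "\<And>U y z. y \<in> bitstrings m \<Longrightarrow> z \<in> bitstrings k \<Longrightarrow> Q y U z = (cmod (G y U (?e k) z))\<^sup>2"
    by simp_all
  \<comment> \<open>Control by a constant family is just \<open>F\<close> acting on the leading
    register and leaving the other alone.\<close>
  obtain F' where F': "circ n (m + k) u F'"
    "\<And>U \<psi> z y. z \<in> bitstrings k \<Longrightarrow> y \<in> bitstrings m \<Longrightarrow> F' U \<psi> (y @ z) = F U (\<lambda>x. \<psi> (x @ z)) y"
    using circ_controlled[OF assms(3) F(1), of k] by blast
  obtain G' where G': "circ n (k + m) v G'"
    "\<And>U \<psi> z y. z \<in> bitstrings k \<Longrightarrow> y \<in> bitstrings m \<Longrightarrow> G' U \<psi> (z @ y) = G y U (\<lambda>x. \<psi> (x @ y)) z"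
    using circ_controlled[OF assms(4), of m v G, OF G(1)] by blast
  \<comment> \<open>This permutation moves the register of the first sampler to the end, where it
    can act as control.\<close>
  let ?s = "\<lambda>x. drop m x @ take m x"
  have inj: "inj_on ?s (bitstrings (k + m))"
  proof (rule inj_onI)
    fix x y assume "x \<in> bitstrings (k + m)" "y \<in> bitstrings (k + m)"
      "drop m x @ take m x = drop m y @ take m y"
    then have "drop m x = drop m y \<and> take m x = take m y"
      by (subst (asm) append_eq_append_conv) (auto simp: bitstrings_def)
    then show "x = y" by (metis append_take_drop_id)
  qed
  have U: "unitary_on (k + m) (perm_mat ?s)"
    by (intro unitary_on_perm_mat inj) (auto simp: bitstrings_def)
  let ?H = "\<lambda>U \<psi>. G' U (apply_mat (k + m) (perm_mat ?s) (F' U \<psi>))"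
  have H: "circ n (k + m) (u + v) ?H"
    using circ_comp[OF circ_apply_mat[OF _ U] G'(1), of u F'] F'(1) by (simp add: add.commute)
  have "?H U (?e (k + m)) (z @ y) = F U (?e m) y * G y U (?e k) z"
    if y: "y \<in> bitstrings m" and z: "z \<in> bitstrings k" for U y z
  proof -
    \<comment> \<open>For the control string \<open>y\<close> the fresh register is still all zero,
      scaled by the amplitude of \<open>y\<close>; linearity of the second circuit then gives a
      product of amplitudes.\<close>
    have swap: "apply_mat (k + m) (perm_mat ?s) (F' U (?e (k + m))) (x @ y)
        = F U (?e m) y * ?e k x" if x: "x \<in> bitstrings k" for x
    proof -
      have init: "?e (k + m) (w @ x) = ?e k x * ?e m w" if "w \<in> bitstrings m" for w
        using that x by (auto simp: basis_state_def bitstrings_def add.commute[of k] replicate_add)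
      have "apply_mat (k + m) (perm_mat ?s) (F' U (?e (k + m))) (x @ y) = F' U (?e (k + m)) (y @ x)"
        using apply_perm_mat[OF inj, of "y @ x" "F' U (?e (k + m))"] x y
          append_mem_bitstrings[OF y x] by (simp add: bitstrings_def add.commute)
      also have "\<dots> = F U (\<lambda>w. ?e (k + m) (w @ x)) y"
        using F'(2)[OF x y] .
      also have "\<dots> = F U (\<lambda>w. ?e k x * ?e m w) y"
        using circ_cong[OF F(1) init, where U = U] by simp
      also have "\<dots> = F U (?e m) y * ?e k x"
        by (simp add: circ_scale[OF F(1)])
      finally show ?thesis .
    qed
    have "?H U (?e (k + m)) (z @ y)
        = G y U (\<lambda>x. apply_mat (k + m) (perm_mat ?s) (F' U (?e (k + m))) (x @ y)) z"
      using G'(2)[OF z y] .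
    also have "\<dots> = G y U (\<lambda>x. F U (?e m) y * ?e k x) z"
      using circ_cong[OF G(1)[OF y] swap, where U = U] by simp
    also have "\<dots> = F U (?e m) y * G y U (?e k) z"
      by (simp add: circ_scale[OF G(1)[OF y]])
    finally show ?thesis .
  qed
  then have "(cmod (?H U (?e (k + m)) (z @ y)))\<^sup>2 = P U y * Q y U z"
    if "y \<in> bitstrings m" "z \<in> bitstrings k" for U y z
    using that by (simp add: F G norm_mult power_mult_distrib)
  moreover have "samplable n (k + m) (u + v) (\<lambda>U y. (cmod (?H U (?e (k + m)) y))\<^sup>2)"
    unfolding samplable_def using H by blast
  ultimately show ?thesis by (intro exI conjI allI ballI)
qed

section \<open>The hybrid argument\<close>

text \<open>In each step the oracle call precedes the unitary, so truncation at \<open>i\<close>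
  stops just before the query of step \<open>i\<close>, counted from 0.\<close>

abbreviation truncate_alg :: "nat \<Rightarrow> qalg \<Rightarrow> qalg" where
  "truncate_alg i A \<equiv> A\<lparr>steps := take i (steps A)\<rparr>"

definition s_queries :: "qalg \<Rightarrow> nat set" where
  "s_queries A = {i. i < length (steps A) \<and> fst (steps A ! i) = OrS}"

text \<open>The queried string follows the control bit. The value of that bit is ignored: this can
  only enlarge the weight, and the sampler needs the string alone.\<close>

definition query_weight :: "nat \<Rightarrow> qalg \<Rightarrow> bool list set \<Rightarrow> bool list set \<Rightarrow> qstate \<Rightarrow>
    bool list set \<Rightarrow> nat \<Rightarrow> real" where
  "query_weight n A S U \<psi> D i = (\<Sum>y\<in>{y \<in> bitstrings (nqubits A). take n (tl y) \<in> D}.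
     (cmod (final_state n (truncate_alg i A) S U \<psi> y))\<^sup>2)"

lemma query_weight_nonneg: "0 \<le> query_weight n A S U \<psi> D i"
  by (simp add: query_weight_def sum_nonneg)

lemma finite_s_queries: "finite (s_queries A)"
  by (simp add: s_queries_def)

lemma card_s_queries: "card (s_queries A) = num_queries OrS A"
  by (simp add: s_queries_def num_queries_def length_filter_conv_card)

lemma num_queries_truncate_le: "num_queries oc (truncate_alg i A) \<le> num_queries oc A"
proof -
  have "num_queries oc A = length (filter (\<lambda>s. fst s = oc) (take i (steps A) @ drop i (steps A)))"
    by (simp add: num_queries_def)
  then show ?thesis unfolding filter_append by (simp add: num_queries_def)
qed

lemma final_state_truncate_Suc:
  assumes "i < length (steps A)"
  shows "final_state n (truncate_alg (Suc i) A) S U \<psi> = apply_mat (nqubits A) (snd (steps A ! i))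
    (oracle_of n S U (fst (steps A ! i)) (final_state n (truncate_alg i A) S U \<psi>))"
  using assms by (simp add: final_state_def take_Suc_conv_app_nth case_prod_unfold)

lemma vnorm_final_state:
  assumes "valid_alg n q A"
  shows "vnorm (nqubits A) (final_state n A S U \<psi>) = vnorm (nqubits A) \<psi>"
proof -
  have "i \<le> length (steps A) \<Longrightarrow>
      vnorm (nqubits A) (final_state n (truncate_alg i A) S U \<psi>) = vnorm (nqubits A) \<psi>" for i
  proof (induction i)
    case 0
    then show ?case using assms by (simp add: final_state_def valid_alg_def vnorm_unitary)
  next
    case (Suc i)
    then have "unitary_on (nqubits A) (snd (steps A ! i))"
      using assms by (simp add: valid_alg_def)
    moreover have "vnorm (nqubits A) (oracle_of n S U oc \<phi>) = vnorm (nqubits A) \<phi>" for oc \<phi>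
      by (cases oc) (simp_all add: oracle_of_def vnorm_phase_oracle)
    ultimately show ?case
      using Suc by (simp add: final_state_truncate_Suc vnorm_unitary)
  qed
  from this[of "length (steps A)"] show ?thesis by simp
qed

text \<open>The two oracles differ only by a sign on queries in \<open>S - \<Delta>\<close>, so each
  query to the first oracle drives the two runs apart by at most twice the norm of that part of the
  state. The weights are taken in the run on \<Delta>, which can be simulated without access to
  \<open>S\<close>.\<close>

lemma hybrid_bound:
  assumes "valid_alg n q A" "\<Delta> \<subseteq> S"
  shows "vnorm (nqubits A) (\<lambda>y. final_state n A S U \<psi> y - final_state n A \<Delta> U \<psi> y)
       \<le> 2 * (\<Sum>i\<in>s_queries A. sqrt (query_weight n A \<Delta> U \<psi> (S - \<Delta>) i))"
proof -
  let ?m = "nqubits A" and ?W = "query_weight n A \<Delta> U \<psi> (S - \<Delta>)"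
  let ?\<psi> = "\<lambda>i. final_state n (truncate_alg i A) S U \<psi>"
  let ?\<phi> = "\<lambda>i. final_state n (truncate_alg i A) \<Delta> U \<psi>"
  have "i \<le> length (steps A) \<Longrightarrow> vnorm ?m (\<lambda>y. ?\<psi> i y - ?\<phi> i y)
      \<le> 2 * (\<Sum>j\<in>{j \<in> s_queries A. j < i}. sqrt (?W j))" for i
  proof (induction i)
    case 0
    have "?\<psi> 0 = ?\<phi> 0" by (simp add: final_state_def)
    then show ?case by (simp add: vnorm_def)
  next
    case (Suc i)
    define oc where "oc = fst (steps A ! i)"
    \<comment> \<open>This is the error added by step \<open>i\<close>: twice the part of the run on
      \<Delta> that may receive the wrong sign.\<close>
    define \<chi> where "\<chi> y = (if oc = OrS \<and> take n (tl y) \<in> S - \<Delta> then 2 * ?\<phi> i y else 0)" for y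
    have "unitary_on ?m (snd (steps A ! i))"
      using assms Suc.prems by (simp add: valid_alg_def)
    then have "vnorm ?m (\<lambda>y. ?\<psi> (Suc i) y - ?\<phi> (Suc i) y)
        = vnorm ?m (\<lambda>y. oracle_of n S U oc (?\<psi> i) y - oracle_of n \<Delta> U oc (?\<phi> i) y)"
      using Suc.prems vnorm_unitary
      by (simp add: final_state_truncate_Suc oc_def flip: apply_mat_diff)
    also have "\<dots> \<le> vnorm ?m (\<lambda>y. ?\<psi> i y - ?\<phi> i y) + vnorm ?m \<chi>"
    proof (rule vnorm_triangle)
      fix y
      \<comment> \<open>Where only the phase for \<open>S\<close> is -1, the difference is
        \<open>- \<psi> - \<phi> = - (\<psi> - \<phi>) - 2 * \<phi>\<close>; elsewhere the two
        phases agree.\<close>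
      have "oracle_of n S U oc (?\<psi> i) y - oracle_of n \<Delta> U oc (?\<phi> i) y
            \<in> {?\<psi> i y - ?\<phi> i y, - (?\<psi> i y - ?\<phi> i y), - (?\<psi> i y - ?\<phi> i y) - \<chi> y}"
        using assms(2) by (cases oc) (auto simp: oracle_of_def phase_oracle_def \<chi>_def)
      then consider "oracle_of n S U oc (?\<psi> i) y - oracle_of n \<Delta> U oc (?\<phi> i) y = ?\<psi> i y - ?\<phi> i y"
        | "oracle_of n S U oc (?\<psi> i) y - oracle_of n \<Delta> U oc (?\<phi> i) y = - (?\<psi> i y - ?\<phi> i y)"
        | "oracle_of n S U oc (?\<psi> i) y - oracle_of n \<Delta> U oc (?\<phi> i) y
            = - (?\<psi> i y - ?\<phi> i y) - \<chi> y" by blast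
      then show "cmod (oracle_of n S U oc (?\<psi> i) y - oracle_of n \<Delta> U oc (?\<phi> i) y)
          \<le> cmod (?\<psi> i y - ?\<phi> i y) + cmod (\<chi> y)"
      proof cases
        case 1
        show ?thesis unfolding 1 by simp
      next
        case 2
        show ?thesis unfolding 2 norm_minus_cancel by simp
      next
        case 3
        show ?thesis unfolding 3
          using norm_triangle_ineq4[of "- (?\<psi> i y - ?\<phi> i y)" "\<chi> y"] by (simp only: norm_minus_cancel)
      qed
    qed
    also have "\<dots> \<le> 2 * (\<Sum>j\<in>{j \<in> s_queries A. j < i}. sqrt (?W j))
        + (if oc = OrS then 2 * sqrt (?W i) else 0)"
    proof (cases oc)
      case OrS
      have "(vnorm ?m \<chi>)\<^sup>2 = (\<Sum>y\<in>bitstrings ?m.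
          if take n (tl y) \<in> S - \<Delta> then 4 * (cmod (?\<phi> i y))\<^sup>2 else 0)"
        unfolding vnorm_power2 by (intro sum.cong) (auto simp: \<chi>_def OrS norm_mult power_mult_distrib)
      also have "\<dots> = 4 * ?W i"
        by (simp add: query_weight_def sum_distrib_left flip: sum.inter_filter)
      also have "\<dots> = (2 * sqrt (?W i))\<^sup>2"
        by (simp add: power_mult_distrib query_weight_nonneg)
      finally have "vnorm ?m \<chi> = 2 * sqrt (?W i)"
        by (rule power2_eq_imp_eq) (simp_all add: vnorm_nonneg query_weight_nonneg)
      then show ?thesis using Suc OrS by simp
    next
      case OrU
      then have "vnorm ?m \<chi> = 0" by (simp add: vnorm_def \<chi>_def)
      then show ?thesis using Suc OrU by simp
    qed
    also have "\<dots> = 2 * (\<Sum>j\<in>{j \<in> s_queries A. j < Suc i}. sqrt (?W j))"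
    proof (cases oc)
      case OrS
      then have "{j \<in> s_queries A. j < Suc i} = insert i {j \<in> s_queries A. j < i}"
        using Suc.prems by (auto simp: s_queries_def oc_def less_Suc_eq)
      then show ?thesis using OrS finite_s_queries by simp
    next
      case OrU
      then have "{j \<in> s_queries A. j < Suc i} = {j \<in> s_queries A. j < i}"
        by (auto simp: s_queries_def oc_def less_Suc_eq)
      then show ?thesis using OrU by simp
    qed
    finally show ?case .
  qed
  from this[of "length (steps A)"] show ?thesis
    by (simp add: s_queries_def conj_ac cong: conj_cong)
qed

definition input_state :: "nat \<Rightarrow> qalg \<Rightarrow> bool list \<Rightarrow> bool list" where
  "input_state q A w = w @ replicate (nqubits A - q) False"

text \<open>The gap \<open>1/3\<close> in acceptance probability is at most twice the sum of the
  square roots of the weights, so this sum is at least \<open>1/6\<close>. The Cauchy-Schwarz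
  inequality over at most \<open>t\<close> queries turns \<open>1/36\<close> into the bound on the
  sum of the weights.\<close>

lemma query_weight_lower_bound:
  assumes "valid_alg n q A" "num_queries OrS A \<le> t" "0 < t" "w \<in> bitstrings q" "\<Delta> \<subseteq> S"
    and "2/3 \<le> acc_prob n q A S U w" "acc_prob n q A \<Delta> U w \<le> 1/3"
  shows "1 / (36 * real t)
    \<le> (\<Sum>i\<in>s_queries A. query_weight n A \<Delta> U (basis_state (input_state q A w)) (S - \<Delta>) i)"
proof -
  let ?\<psi> = "basis_state (input_state q A w)"
  let ?W = "query_weight n A \<Delta> U ?\<psi> (S - \<Delta>)"
  let ?s = "\<Sum>i\<in>s_queries A. sqrt (?W i)"
  have "input_state q A w \<in> bitstrings (nqubits A)"
    using assms by (simp add: input_state_def bitstrings_def valid_alg_def)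
  then have "vnorm (nqubits A) (final_state n A X U ?\<psi>) = 1" for X
    using vnorm_final_state[OF assms(1)] by (simp add: vnorm_basis_state)
  then have "acc_prob n q A S U w - acc_prob n q A \<Delta> U w
      \<le> vnorm (nqubits A) (\<lambda>y. final_state n A S U ?\<psi> y - final_state n A \<Delta> U ?\<psi> y)"
    unfolding acc_prob_def input_state_def[symmetric] by (intro prob_diff_le_vnorm_diff) auto
  also have "\<dots> \<le> 2 * ?s" by (rule hybrid_bound) fact+
  finally have "1/6 \<le> ?s" using assms by simp
  then have "(1/6)\<^sup>2 \<le> ?s\<^sup>2" by (intro power_mono) simp_all
  also have "\<dots> \<le> (\<Sum>i\<in>s_queries A. (sqrt (?W i))\<^sup>2) * card (s_queries A)"
    by (rule sum_squared_le_sum_of_squares)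
  also have "\<dots> \<le> (\<Sum>i\<in>s_queries A. ?W i) * real t"
    using assms by (intro mult_mono) (auto simp: query_weight_nonneg card_s_queries sum_nonneg)
  finally show ?thesis using assms(3) by (simp add: field_simps power2_eq_square)
qed

section \<open>One round of the sampler\<close>

text \<open>The input is prepared by a unitary whose column at the all-zero string is the basis
  vector of \<open>x\<close>.\<close>

lemma samplable_basis_input:
  assumes "circ n m u F" "x \<in> bitstrings m"
  shows "samplable n m u (\<lambda>U y. (cmod (F U (basis_state x) y))\<^sup>2)"
proof -
  have "(\<Sum>y\<in>bitstrings m. (if y = x then 1 else 0 :: real)\<^sup>2) = 1"
    using assms(2) by (simp add: if_distrib[of "\<lambda>a. a ^ _"] cong: if_cong)
  then obtain M where M: "unitary_on m M"
    "\<forall>y\<in>bitstrings m. M y (replicate m False) = complex_of_real (if y = x then 1 else 0)"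
    using unitary_with_real_column[of "\<lambda>y. if y = x then 1 else 0" m "replicate m False"] by auto
  have "F U (apply_mat m M (basis_state (replicate m False))) = F U (basis_state x)" for U
    by (rule circ_cong[OF assms(1)]) (use M(2) in \<open>simp add: apply_mat_basis_state, simp add: basis_state_def\<close>)
  moreover have "circ n m u (\<lambda>U \<psi>. F U (apply_mat m M \<psi>))"
    using circ_comp[OF circ_unitary[OF M(1)] assms(1)] by simp
  ultimately show ?thesis
    unfolding samplable_def by (intro exI[of _ "\<lambda>U \<psi>. F U (apply_mat m M \<psi>)"]) simp
qed

text \<open>Simulate \<open>A\<close> with \<open>\<Delta>\<close> in place of \<open>S\<close> up to a uniformly random position among \<open>t\<close>
  positions that include all its queries to \<open>S\<close>.\<close>

lemma samplable_query:
  assumes A: "valid_alg n q A" "num_queries OrS A \<le> t" "num_queries OrU A \<le> t" "0 < t"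
    and w: "w \<in> bitstrings q"
  shows "\<exists>R. samplable n (nqubits A + (t + n + 1)) t R \<and>
    (\<forall>S U. \<Delta> \<subseteq> S \<longrightarrow> 2/3 \<le> acc_prob n q A S U w \<and> acc_prob n q A \<Delta> U w \<le> 1/3 \<longrightarrow>
      1 / (36 * (real t)\<^sup>2) \<le> (\<Sum>z\<in>{z \<in> bitstrings (nqubits A + (t + n + 1)). take n (tl z) \<in> S - \<Delta>}. R U z))"
proof -
  \<comment> \<open>In the register for the random position, \<open>t\<close> bits suffice to name
    \<open>t\<close> positions; the other \<open>n + 1\<close> bits meet the size condition of
    \<open>samplable_bind\<close>.\<close>
  let ?m = "nqubits A" and ?l = "t + n + 1"
  let ?\<psi> = "basis_state (input_state q A w)"
  let ?I = "s_queries A"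
  have m: "n < ?m" using A by (simp add: valid_alg_def)
  \<comment> \<open>Other positions fill the set up to exactly \<open>t\<close> elements, each to be
    drawn with probability \<open>1 / t\<close>. A filler beyond the last step is harmless, since
    \<open>take\<close> then keeps all steps.\<close>
  obtain T where T: "finite T" "card T = t - card ?I" "T \<subseteq> - ?I"
    using infinite_arbitrarily_large[of "- ?I"] finite_s_queries[of A] by auto
  define J where "J = ?I \<union> T"
  have "card J = card ?I + card T"
    unfolding J_def using T finite_s_queries by (intro card_Un_disjoint) auto
  then have J: "finite J" "card J = t" "?I \<subseteq> J"
    using T A finite_s_queries[of A] by (auto simp: J_def card_s_queries)
  have "card J \<le> card (bitstrings ?l)"
  proof -
    have "t < 2 ^ t" by (rule less_exp)
    also have "(2::nat) ^ t \<le> 2 ^ ?l" by (intro power_increasing) auto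
    finally show ?thesis by (simp add: J card_bitstrings)
  qed
  \<comment> \<open>The injection \<open>g\<close> encodes positions as bit strings, and
    \<open>inv_into J g\<close> decodes them.\<close>
  then obtain g where g: "inj_on g J" "g ` J \<subseteq> bitstrings ?l"
    using inj_on_iff_card_le[of J "bitstrings ?l"] J by auto
  define p :: "bool list \<Rightarrow> real" where "p x = (if x \<in> g ` J then 1 / real t else 0)" for x
  have p: "samplable n ?l 0 (\<lambda>U. p)"
  proof (rule samplable_const)
    have "(\<Sum>x\<in>bitstrings ?l. p x) = (\<Sum>x\<in>g ` J. 1 / real t)"
      unfolding p_def using g by (simp add: sum.If_cases Int_absorb1)
    also have "\<dots> = 1" using g J A by (simp add: card_image)
    finally show "(\<Sum>x\<in>bitstrings ?l. p x) = 1" .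
  qed (simp add: p_def)
  \<comment> \<open>Every truncated run is padded to exactly \<open>t\<close> queries to
    \<open>U\<close>, so that the runs can be controlled by the random position.\<close>
  have stage: "\<exists>Q. samplable n ?m t Q \<and> (\<forall>U. \<forall>z\<in>bitstrings ?m.
      Q U z = (cmod (final_state n (truncate_alg i A) \<Delta> U ?\<psi> z))\<^sup>2)" for i
  proof -
    have "circ n ?m (num_queries OrU (truncate_alg i A)) (\<lambda>U. final_state n (truncate_alg i A) \<Delta> U)"
      using A(1) by (intro circ_final_state) (auto simp: valid_alg_def dest: in_set_takeD)
    from circ_pad[OF this, of t] obtain G where G: "circ n ?m t G"
      "\<forall>U \<psi>. \<forall>y\<in>bitstrings ?m. cmod (G U \<psi> y) = cmod (final_state n (truncate_alg i A) \<Delta> U \<psi> y)"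
      using num_queries_truncate_le[of OrU i A] A(3) by auto
    have "input_state q A w \<in> bitstrings ?m"
      using A w by (simp add: input_state_def bitstrings_def valid_alg_def)
    from samplable_basis_input[OF G(1) this] G(2) show ?thesis
      by (intro exI[of _ "\<lambda>U y. (cmod (G U ?\<psi> y))\<^sup>2"]) simp
  qed
  define Q where "Q i = (SOME Q. samplable n ?m t Q \<and> (\<forall>U. \<forall>z\<in>bitstrings ?m.
      Q U z = (cmod (final_state n (truncate_alg i A) \<Delta> U ?\<psi> z))\<^sup>2))" for i
  have Q: "samplable n ?m t (Q i)"
    "\<forall>U. \<forall>z\<in>bitstrings ?m. Q i U z = (cmod (final_state n (truncate_alg i A) \<Delta> U ?\<psi> z))\<^sup>2" for i
    using someI_ex[OF stage[of i]] unfolding Q_def by auto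
  obtain R where R: "samplable n (?m + ?l) t R"
    "\<forall>U. \<forall>x\<in>bitstrings ?l. \<forall>z\<in>bitstrings ?m. R U (z @ x) = p x * Q (inv_into J g x) U z"
    using samplable_bind[OF p Q(1), of "inv_into J g"] m by auto
  have "1 / (36 * (real t)\<^sup>2) \<le> (\<Sum>z\<in>{z \<in> bitstrings (?m + ?l). take n (tl z) \<in> S - \<Delta>}. R U z)"
    if "\<Delta> \<subseteq> S" "2/3 \<le> acc_prob n q A S U w" "acc_prob n q A \<Delta> U w \<le> 1/3" for S U
  proof -
    let ?W = "query_weight n A \<Delta> U ?\<psi> (S - \<Delta>)"
    \<comment> \<open>As \<open>n < ?m\<close>, the queried string is read from the register of
      \<open>A\<close> alone.\<close>
    have tl: "take n (tl (z @ x)) = take n (tl z)" if "z \<in> bitstrings ?m" for z x :: "bool list"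
      using that m by (cases z) (auto simp: bitstrings_def)
    have "1 / (36 * (real t)\<^sup>2) = 1 / real t * (1 / (36 * real t))"
      by (simp add: power2_eq_square)
    also have "\<dots> \<le> 1 / real t * (\<Sum>i\<in>?I. ?W i)"
      using query_weight_lower_bound[OF A(1,2,4) w that] by (intro mult_left_mono) auto
    also have "\<dots> \<le> 1 / real t * (\<Sum>i\<in>J. ?W i)"
      using J by (intro mult_left_mono sum_mono2) (auto simp: query_weight_nonneg)
    also have "\<dots> = (\<Sum>i\<in>J. p (g i) * ?W (inv_into J g (g i)))"
      using g by (simp add: p_def sum_divide_distrib)
    also have "\<dots> = (\<Sum>x\<in>g ` J. p x * ?W (inv_into J g x))"
      using g by (simp add: sum.reindex)
    also have "\<dots> = (\<Sum>x\<in>bitstrings ?l. p x * ?W (inv_into J g x))"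
      using g by (intro sum.mono_neutral_left) (auto simp: p_def)
    also have "\<dots> = (\<Sum>x\<in>bitstrings ?l. \<Sum>z\<in>bitstrings ?m.
        if take n (tl (z @ x)) \<in> S - \<Delta> then R U (z @ x) else 0)"
    proof (intro sum.cong refl)
      fix x assume x: "x \<in> bitstrings ?l"
      have "p x * ?W (inv_into J g x) = (\<Sum>z\<in>{z \<in> bitstrings ?m. take n (tl z) \<in> S - \<Delta>}. R U (z @ x))"
        unfolding query_weight_def sum_distrib_left using x R(2) Q(2) by (intro sum.cong) auto
      also have "\<dots> = (\<Sum>z\<in>bitstrings ?m. if take n (tl z) \<in> S - \<Delta> then R U (z @ x) else 0)"
        by (rule sum.inter_filter) simp
      also have "\<dots> = (\<Sum>z\<in>bitstrings ?m. if take n (tl (z @ x)) \<in> S - \<Delta> then R U (z @ x) else 0)"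
        by (intro sum.cong refl) (simp only: tl)
      finally show "p x * ?W (inv_into J g x) = (\<Sum>z\<in>bitstrings ?m.
        if take n (tl (z @ x)) \<in> S - \<Delta> then R U (z @ x) else 0)" .
    qed
    also have "\<dots> = (\<Sum>z\<in>bitstrings (?m + ?l). if take n (tl z) \<in> S - \<Delta> then R U z else 0)"
      by (rule sum_bitstrings_add[symmetric])
    also have "\<dots> = (\<Sum>z\<in>{z \<in> bitstrings (?m + ?l). take n (tl z) \<in> S - \<Delta>}. R U z)"
      by (rule sum.inter_filter[symmetric]) simp
    finally show ?thesis .
  qed
  with R(1) show ?thesis by (intro exI[of _ R]) simp
qed

section \<open>Iterating the rounds\<close>

lemma chunks_append_left:
  assumes "length a = n"
  shows "chunks n (Suc j) (a @ y) = a # chunks n j y"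
proof -
  have "chunks n (Suc j) (a @ y)
      = map (\<lambda>i. take n (drop (i * n) (a @ y))) (0 # map Suc [0..<j])"
    unfolding chunks_def by (simp add: upt_conv_Cons map_Suc_upt del: upt_Suc)
  then show ?thesis using assms by (simp add: chunks_def)
qed

lemma chunks_append_right:
  assumes "j * n \<le> length y"
  shows "chunks n j (y @ r) = chunks n j y"
  unfolding chunks_def
proof (rule map_cong)
  fix i assume "i \<in> set [0..<j]"
  then have "Suc i * n \<le> j * n" by (intro mult_le_mono1) auto
  then show "take n (drop (i * n) (y @ r)) = take n (drop (i * n) y)"
    using assms by simp
qed simp

definition good_outcomes :: "nat \<Rightarrow> nat \<Rightarrow> nat \<Rightarrow> nat \<Rightarrow> bool list set \<Rightarrow> bool list \<Rightarrow> bool list set" where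
  "good_outcomes n q N j S w = {y \<in> bitstrings N. distinct (chunks n j y) \<and>
     set (chunks n j y) \<subseteq> S \<and> take q (drop (j * n) y) = w}"

text \<open>Conditioned on a good outcome so far, the next round succeeds with probability at least
  \<open>c\<close>, so every round contributes one factor \<open>c\<close>; the factor
  \<open>(1/2) ^ q\<close> is the chance of guessing \<open>w\<close>. The predicate
  \<open>C\<close> stands for the assumption under which a round succeeds. It is required only for
  sets of fewer than \<open>j\<close> elements, because the last round starts from
  \<open>j - 1\<close> of them.\<close>

lemma samplable_iterate:
  fixes c :: real
  assumes "n < k" "0 \<le> c"
    and round: "\<And>w \<Delta>. w \<in> bitstrings q \<Longrightarrow> \<exists>R. samplable n k t R \<and>
      (\<forall>S U. \<Delta> \<subseteq> S \<longrightarrow> C S U w \<Delta> \<longrightarrow> c \<le> (\<Sum>z\<in>{z \<in> bitstrings k. take n (tl z) \<in> S - \<Delta>}. R U z))"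
  shows "\<exists>N P. j * n + q \<le> N \<and> n < N \<and> samplable n N (j * t) P \<and>
    (\<forall>S U w. w \<in> bitstrings q \<longrightarrow> (\<forall>\<Delta>. \<Delta> \<subseteq> S \<longrightarrow> card \<Delta> < j \<longrightarrow> C S U w \<Delta>) \<longrightarrow>
      (1/2) ^ q * c ^ j \<le> (\<Sum>y\<in>good_outcomes n q N j S w. P U y))"
proof (induction j)
  case 0
  \<comment> \<open>The uniformly random witness is followed by \<open>n + 1\<close> zero bits,
    which ensure \<open>n < N\<close> however small \<open>q\<close> is.\<close>
  let ?r = "replicate (n + 1) False"
  define p :: "bool list \<Rightarrow> real" where "p y = (if drop q y = ?r then (1/2) ^ q else 0)" for y
  have "samplable n (q + (n + 1)) 0 (\<lambda>U. p)"
  proof (rule samplable_const)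
    have "(\<Sum>y\<in>bitstrings (q + (n + 1)). p y)
        = (\<Sum>z\<in>bitstrings (n + 1). if z = ?r then 2 ^ q * (1/2) ^ q else 0)"
      unfolding sum_bitstrings_add by (intro sum.cong refl)
        (auto simp: p_def bitstrings_def[of q] card_bitstrings[unfolded bitstrings_def])
    also have "\<dots> = 2 ^ q * (1/2 :: real) ^ q"
      by (simp only: sum.delta finite_bitstrings replicate_mem_bitstrings if_True)
    also have "\<dots> = 1" by (simp flip: power_mult_distrib)
    finally show "(\<Sum>y\<in>bitstrings (q + (n + 1)). p y) = 1" .
  qed (simp add: p_def)
  moreover have "(1/2) ^ q \<le> (\<Sum>y\<in>good_outcomes n q (q + (n + 1)) 0 S w. p y)"
    if w: "w \<in> bitstrings q" for S w
  proof -
    have "p (w @ ?r) \<le> (\<Sum>y\<in>good_outcomes n q (q + (n + 1)) 0 S w. p y)"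
    proof (rule member_le_sum)
      show "w @ ?r \<in> good_outcomes n q (q + (n + 1)) 0 S w"
        using w by (simp add: good_outcomes_def chunks_def bitstrings_def)
    qed (auto simp: p_def good_outcomes_def)
    then show ?thesis using w by (simp add: p_def bitstrings_def)
  qed
  ultimately show ?case
    by (intro exI[of _ "q + (n + 1)"] exI[of _ "\<lambda>U. p"]) simp
next
  case (Suc j)
  then obtain N P where N: "j * n + q \<le> N" "n < N" and P: "samplable n N (j * t) P"
    and good: "\<And>S U w. w \<in> bitstrings q \<Longrightarrow> \<forall>\<Delta>. \<Delta> \<subseteq> S \<longrightarrow> card \<Delta> < j \<longrightarrow> C S U w \<Delta> \<Longrightarrow>
      (1/2) ^ q * c ^ j \<le> (\<Sum>y\<in>good_outcomes n q N j S w. P U y)"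
    by blast
  \<comment> \<open>Every string \<open>y\<close>, good or not, encodes a witness and a found set,
    and hence a round that can be run under its control.\<close>
  have "\<forall>y\<in>bitstrings N. \<exists>R. samplable n k t R \<and> (\<forall>S U. set (chunks n j y) \<subseteq> S \<longrightarrow>
      C S U (take q (drop (j * n) y)) (set (chunks n j y)) \<longrightarrow>
      c \<le> (\<Sum>z\<in>{z \<in> bitstrings k. take n (tl z) \<in> S - set (chunks n j y)}. R U z))"
    using N by (intro ballI round) (simp add: bitstrings_def)
  from bchoice[OF this] obtain Q where Q: "\<forall>y\<in>bitstrings N. samplable n k t (Q y) \<and>
      (\<forall>S U. set (chunks n j y) \<subseteq> S \<longrightarrow>
      C S U (take q (drop (j * n) y)) (set (chunks n j y)) \<longrightarrow>
      c \<le> (\<Sum>z\<in>{z \<in> bitstrings k. take n (tl z) \<in> S - set (chunks n j y)}. Q y U z))"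
    by (rule exE)
  obtain R where R: "samplable n (k + N) (j * t + t) R"
    "\<forall>U. \<forall>y\<in>bitstrings N. \<forall>z\<in>bitstrings k. R U (z @ y) = P U y * Q y U z"
    using samplable_bind[OF P, of k t Q] Q N assms(1) by auto
  \<comment> \<open>The permutation \<open>f\<close> brings the newly queried string to the front
    and the rest of the new register to the end, which restores the layout of
    \<open>good_outcomes\<close> for \<open>Suc j\<close>.\<close>
  define f where "f x = take n (tl x) @ drop k x @ hd x # take (k - Suc n) (drop (Suc n) x)"
    for x :: "bool list"
  have f: "f (z @ y) = take n (tl z) @ y @ hd z # drop n (tl z)" if z: "z \<in> bitstrings k" for z y
    using z assms(1) by (cases z) (auto simp: f_def bitstrings_def)
  have inj: "inj_on f (bitstrings (k + N))"
  proof (rule inj_onI)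
    fix x x' assume x: "x \<in> bitstrings (k + N)" "x' \<in> bitstrings (k + N)" "f x = f x'"
    obtain z y z' y' where zy: "x = z @ y" "x' = z' @ y'" "z \<in> bitstrings k" "z' \<in> bitstrings k"
      "y \<in> bitstrings N" "y' \<in> bitstrings N"
      using x unfolding bitstrings_add by auto
    obtain b u b' u' where bu: "z = b # u" "z' = b' # u'"
      using zy assms(1) by (cases z; cases z') (auto simp: bitstrings_def)
    have "take n u @ y @ b # drop n u = take n u' @ y' @ b' # drop n u'"
      using x(3) f[OF zy(3), of y] f[OF zy(4), of y'] zy bu by simp
    moreover have len: "length (take n u) = length (take n u')" "length y = length y'"
      using zy bu by (auto simp: bitstrings_def)
    ultimately have "take n u = take n u'" "y @ b # drop n u = y' @ b' # drop n u'"
      by (simp_all only: append_eq_append_conv[OF disjI1[OF len(1)]])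
    moreover from this(2) have "y = y'" "b = b'" "drop n u = drop n u'"
      by (simp_all only: append_eq_append_conv[OF disjI1[OF len(2)]] list.inject)
    ultimately have "u = u'" by (metis append_take_drop_id)
    then show "x = x'" using zy(1,2) bu \<open>y = y'\<close> \<open>b = b'\<close> by (simp only:)
  qed
  have "f ` bitstrings (k + N) \<subseteq> bitstrings (k + N)"
    using assms(1) by (auto simp: f_def bitstrings_def)
  from samplable_perm[OF R(1) inj this] obtain P' where P': "samplable n (k + N) (j * t + t) P'"
    "\<forall>U. \<forall>x\<in>bitstrings (k + N). P' U (f x) = R U x" by blast
  have "(1/2) ^ q * c ^ Suc j \<le> (\<Sum>y\<in>good_outcomes n q (k + N) (Suc j) S w. P' U y)"
    if w: "w \<in> bitstrings q" and C: "\<forall>\<Delta>. \<Delta> \<subseteq> S \<longrightarrow> card \<Delta> < Suc j \<longrightarrow> C S U w \<Delta>" for S U w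
  proof -
    let ?G = "good_outcomes n q N j S w"
    let ?Z = "\<lambda>y. {z \<in> bitstrings k. take n (tl z) \<in> S - set (chunks n j y)}"
    let ?h = "\<lambda>(y, z). f (z @ y)"
    have sub: "?G \<subseteq> bitstrings N" by (auto simp: good_outcomes_def)
    then have fin: "finite ?G" by (rule finite_subset) simp
    \<comment> \<open>Different pairs of an old outcome and a successful round give different
      outcomes, so their probabilities add up.\<close>
    have inj_h: "inj_on ?h (SIGMA y:?G. ?Z y)"
    proof (rule inj_onI, clarify)
      fix y z y' z'
      assume *: "y \<in> ?G" "y' \<in> ?G" "z \<in> bitstrings k" "z' \<in> bitstrings k" "f (z @ y) = f (z' @ y')"
      then have "z @ y = z' @ y'"
        using sub inj_onD[OF inj *(5)] append_mem_bitstrings by blast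
      then show "y = y' \<and> z = z'" using * by (simp add: bitstrings_def)
    qed
    have img: "?h ` (SIGMA y:?G. ?Z y) \<subseteq> good_outcomes n q (k + N) (Suc j) S w"
    proof clarify
      fix y z assume y: "y \<in> ?G" and z: "z \<in> bitstrings k" "take n (tl z) \<in> S" "take n (tl z) \<notin> set (chunks n j y)"
      have len: "length (take n (tl z)) = n" "length y = N"
        using z(1) y sub assms(1) by (auto simp: bitstrings_def)
      have "chunks n (Suc j) (f (z @ y)) = take n (tl z) # chunks n j y"
        using N len by (simp add: f[OF z(1)] chunks_append_left chunks_append_right del: length_take)
      moreover have "take q (drop (Suc j * n) (f (z @ y))) = w"
        using N y len by (simp add: f[OF z(1)] good_outcomes_def)
      moreover have "f (z @ y) \<in> bitstrings (k + N)"
        using len z(1) assms(1) by (simp add: f[OF z(1)] bitstrings_def)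
      ultimately show "f (z @ y) \<in> good_outcomes n q (k + N) (Suc j) S w"
        using y z by (simp add: good_outcomes_def)
    qed
    have "(1/2) ^ q * c ^ Suc j = (1/2) ^ q * c ^ j * c" by simp
    also have "\<dots> \<le> (\<Sum>y\<in>?G. P U y) * c"
      using good[OF w, of S U] C assms(2) by (intro mult_right_mono) auto
    also have "\<dots> \<le> (\<Sum>y\<in>?G. P U y * (\<Sum>z\<in>?Z y. Q y U z))"
      unfolding sum_distrib_right
    proof (intro sum_mono mult_left_mono)
      fix y assume y: "y \<in> ?G"
      have "card (set (chunks n j y)) < Suc j"
        using card_length[of "chunks n j y"] by (simp add: chunks_def)
      then have "C S U (take q (drop (j * n) y)) (set (chunks n j y))"
        using y C by (simp add: good_outcomes_def)
      then show "c \<le> (\<Sum>z\<in>?Z y. Q y U z)"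
        using Q y sub by (auto simp: good_outcomes_def)
      show "0 \<le> P U y" using P y sub by (auto intro: samplable_nonneg)
    qed
    also have "\<dots> = (\<Sum>y\<in>?G. \<Sum>z\<in>?Z y. P' U (f (z @ y)))"
      unfolding sum_distrib_left
    proof (intro sum.cong refl)
      fix y z assume "y \<in> ?G" "z \<in> ?Z y"
      then have "y \<in> bitstrings N" "z \<in> bitstrings k" using sub by auto
      then show "P U y * Q y U z = P' U (f (z @ y))"
        using P'(2) R(2) append_mem_bitstrings[of z k y N] by simp
    qed
    also have "\<dots> = (\<Sum>x\<in>?h ` (SIGMA y:?G. ?Z y). P' U x)"
      using fin inj_h by (simp add: sum.Sigma sum.reindex case_prod_unfold)
    also have "\<dots> \<le> (\<Sum>y\<in>good_outcomes n q (k + N) (Suc j) S w. P' U y)"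
      using img by (intro sum_mono2) (auto simp: good_outcomes_def intro: samplable_nonneg[OF P'(1)])
    finally show ?thesis .
  qed
  then show ?case
    using P'(1) N assms(1) by (intro exI[of _ "k + N"] exI[of _ P']) (simp add: add.commute)
qed

section \<open>Assembling the sampler\<close>

theorem mainTheorem2:
  fixes n q t v :: nat and A :: qalg
  assumes "n > 0" and "q > 0" and "t > 0"
    and "valid_alg n q A"
    and "num_queries OrS A \<le> t" and "num_queries OrU A \<le> t"
    and "\<forall>S U. S \<subseteq> bitstrings n \<longrightarrow> U \<subseteq> bitstrings n \<longrightarrow> spec_forr n S U \<ge> 59/100 \<longrightarrow>
           (\<exists>w\<in>bitstrings q. acc_prob n q A S U w \<ge> 2/3)"
    and "\<forall>S U. S \<subseteq> bitstrings n \<longrightarrow> U \<subseteq> bitstrings n \<longrightarrow> spec_forr n S U \<le> 57/100 \<longrightarrow>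
           (\<forall>w\<in>bitstrings q. acc_prob n q A S U w \<le> 1/3)"
  shows "\<exists>B. valid_alg n 0 B \<and> nqubits B \<ge> v * n \<and>
           num_queries OrS B = 0 \<and> num_queries OrU B = v * t \<and>
           (\<forall>S U. S \<subseteq> bitstrings n \<longrightarrow> U \<subseteq> bitstrings n \<longrightarrow> spec_forr n S U \<ge> 59/100 \<longrightarrow>
              (\<forall>\<Delta>. \<Delta> \<subseteq> S \<longrightarrow> card \<Delta> \<le> v \<longrightarrow> spec_forr n \<Delta> U \<le> 57/100) \<longrightarrow>
              sample_prob n v B S U \<ge> (1/2) ^ q * (1 / (36 * (real t)\<^sup>2)) ^ v)"
proof -
  let ?c = "1 / (36 * (real t)\<^sup>2)"
  \<comment> \<open>The predicate \<open>C\<close> of \<open>samplable_iterate\<close> becomes the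
    condition that \<open>A\<close> with witness \<open>w\<close> separates \<open>(S, U)\<close>
    from \<open>(\<Delta>, U)\<close>.\<close>
  have "\<exists>N P. v * n + q \<le> N \<and> n < N \<and> samplable n N (v * t) P \<and>
    (\<forall>S U w. w \<in> bitstrings q \<longrightarrow> (\<forall>\<Delta>. \<Delta> \<subseteq> S \<longrightarrow> card \<Delta> < v \<longrightarrow>
        2/3 \<le> acc_prob n q A S U w \<and> acc_prob n q A \<Delta> U w \<le> 1/3) \<longrightarrow>
      (1/2) ^ q * ?c ^ v \<le> (\<Sum>y\<in>good_outcomes n q N v S w. P U y))"
    by (rule samplable_iterate[OF _ _ samplable_query[OF assms(4,5,6,3)]]) auto
  then obtain N P where N: "v * n + q \<le> N" "n < N" and P: "samplable n N (v * t) P"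
    and good: "\<And>S U w. w \<in> bitstrings q \<Longrightarrow> \<forall>\<Delta>. \<Delta> \<subseteq> S \<longrightarrow> card \<Delta> < v \<longrightarrow>
        2/3 \<le> acc_prob n q A S U w \<and> acc_prob n q A \<Delta> U w \<le> 1/3 \<Longrightarrow>
      (1/2) ^ q * ?c ^ v \<le> (\<Sum>y\<in>good_outcomes n q N v S w. P U y)"
    by blast
  obtain F where F: "circ n N (v * t) F"
    "\<forall>U. \<forall>y\<in>bitstrings N. P U y = (cmod (F U (basis_state (replicate N False)) y))\<^sup>2"
    using P unfolding samplable_def by blast
  obtain B where B: "valid_alg n 0 B" "nqubits B = N" "num_queries OrS B = 0"
    "num_queries OrU B = v * t" "\<forall>S U \<psi>. final_state n B S U \<psi> = F U \<psi>"
    using circ_imp_qalg[OF F(1) N(2)] by blast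
  have "(1/2) ^ q * ?c ^ v \<le> sample_prob n v B S U"
    if S: "S \<subseteq> bitstrings n" and U: "U \<subseteq> bitstrings n" and forr: "59/100 \<le> spec_forr n S U"
      and \<Delta>: "\<forall>\<Delta>. \<Delta> \<subseteq> S \<longrightarrow> card \<Delta> \<le> v \<longrightarrow> spec_forr n \<Delta> U \<le> 57/100" for S U
  proof -
    obtain w where w: "w \<in> bitstrings q" "2/3 \<le> acc_prob n q A S U w"
      using assms(7) S U forr by blast
    have "acc_prob n q A \<Delta>' U w \<le> 1/3" if "\<Delta>' \<subseteq> S" "card \<Delta>' < v" for \<Delta>'
      using assms(8) \<Delta> that S U w(1) by (meson order.trans less_imp_le)
    then have "(1/2) ^ q * ?c ^ v \<le> (\<Sum>y\<in>good_outcomes n q N v S w. P U y)"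
      using w by (intro good) auto
    \<comment> \<open>A sample counts whichever witness was guessed; dropping the condition on the
      guess only adds nonnegative terms.\<close>
    also have "\<dots> \<le> (\<Sum>y\<in>{y \<in> bitstrings N. distinct (chunks n v y) \<and> set (chunks n v y) \<subseteq> S}. P U y)"
      by (intro sum_mono2) (auto simp: good_outcomes_def intro: samplable_nonneg[OF P])
    also have "\<dots> = sample_prob n v B S U"
      using F(2) B unfolding sample_prob_def by (intro sum.cong) auto
    finally show ?thesis .
  qed
  then show ?thesis using B N by (intro exI[of _ B]) auto
qed

end
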